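(* Let $G$ be a connected finite or infinite and countable weighted graph with Laplacian $\mathcal{L}$ as in the context. Suppose that $\Xi=\{\Omega_j\}$ is a disjoint cover of $V(G)$ by connected and finite subgraphs $\Omega_j$ (each with more than one vertex), let $\lambda_{1,j}$ be the first nonzero eigenvalue of the Laplacian of the induced graph $\Omega_j$, and assume $\Lambda_\Xi=\inf_j\lambda_{1,j}>0$. Let $\alpha>0$ and $\omega>0$. If $$\gamma=\frac{1+\alpha}{\alpha}\frac{\omega}{\Lambda_\Xi}<1,$$ then the set of functionals $f\mapsto\langle f,\xi_j\rangle$ with $\xi_j=|\Omega_j|^{-1/2}\chi_{\Omega_j}$ is a frame in $PW_\omega(\mathcal{L})$; namely, for all $f\in PW_\omega(\mathcal{L})$, $$\frac{1-\gamma}{1+\alpha}\|f\|^2\le\sum_j|\langle f,\xi_j\rangle|^2\le\|f\|^2 .$$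
   Context: $G$ is an undirected weighted graph with vertex set $V(G)$ and weight function $w:V(G)\times V(G)\to[0,\infty)$, $w(u,v)=w(v,u)$, $w(u,u)=0$; edges are the pairs with $w(u,v)\ne0$. If $G$ is infinite, the degrees are assumed uniformly bounded: $\sum_{u}w(u,v)\le c$ for all $v$ and some constant $c$. $L_2(G)$ is the Hilbert space of complex functions on $V(G)$ with $\langle f,g\rangle=\sum_vf(v)\overline{g(v)}$ and finite norm. $\mathcal{L}$ is the bounded non-negative self-adjoint operator $(\mathcal{L}f)(v)=\sum_{u\in V(G)}(f(v)-f(u))w(v,u)$ on $L_2(G)$. The induced graph on $\Omega\subset V(G)$ has vertex set $\Omega$ and all edges of $G$ with both ends in $\Omega$, with weights the restriction of $w$; its Laplacian is given by the same formula with $V(G)$ replaced by $\Omega$. $|\Omega|$ is the number of vertices of $\Omega$, $\chi_\Omega$ its characteristic function. $PW_\omega(\mathcal{L})$ is the range of the spectral projector $\mathbf{1}_{[0,\omega]}(\mathcal{L})$; on it $\|\mathcal{L}^{1/2}f\|\le\sqrt\omega\|f\|$. *)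

theory Defs
  imports "HOL-Analysis.Analysis"
begin

subsection \<open>Weighted graphs\<close>

text \<open>A graph is given by a vertex set \<open>V\<close> and a weight function \<open>w\<close>, of which only the
  values on \<open>V \<times> V\<close> matter.  The induced graph on \<open>S \<subseteq> V\<close> is thus given by \<open>S\<close> and the same \<open>w\<close>.\<close>

definition weighted_graph :: "'v set \<Rightarrow> ('v \<Rightarrow> 'v \<Rightarrow> real) \<Rightarrow> bool" where
  "weighted_graph V w \<longleftrightarrow>
     countable V \<and>
     (\<forall>u\<in>V. \<forall>v\<in>V. 0 \<le> w u v \<and> w u v = w v u) \<and>
     (\<forall>v\<in>V. w v v = 0) \<and>
     (infinite V \<longrightarrow>
        (\<exists>c. \<forall>v\<in>V. (\<lambda>u. w u v) summable_on V \<and> (\<Sum>\<^sub>\<infinity>u\<in>V. w u v) \<le> c))"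

definition edges :: "'v set \<Rightarrow> ('v \<Rightarrow> 'v \<Rightarrow> real) \<Rightarrow> ('v \<times> 'v) set" where
  "edges S w = {(u, v). u \<in> S \<and> v \<in> S \<and> w u v \<noteq> 0}"

definition connected_graph :: "'v set \<Rightarrow> ('v \<Rightarrow> 'v \<Rightarrow> real) \<Rightarrow> bool" where
  "connected_graph S w \<longleftrightarrow> (\<forall>u\<in>S. \<forall>v\<in>S. (u, v) \<in> (edges S w)\<^sup>*)"

subsection \<open>The Hilbert space of square-summable functions\<close>

text \<open>A function on \<open>S\<close> is represented by its extension by zero to the whole type, so that
  equality of functions on \<open>S\<close> is equality in HOL.\<close>

definition L2 :: "'v set \<Rightarrow> ('v \<Rightarrow> complex) set" where
  "L2 S = {f. (\<forall>v. v \<notin> S \<longrightarrow> f v = 0) \<and> (\<lambda>v. (cmod (f v))\<^sup>2) summable_on S}"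

definition L2_inner :: "'v set \<Rightarrow> ('v \<Rightarrow> complex) \<Rightarrow> ('v \<Rightarrow> complex) \<Rightarrow> complex" where
  "L2_inner S f g = (\<Sum>\<^sub>\<infinity>v\<in>S. f v * cnj (g v))"

definition L2_norm :: "'v set \<Rightarrow> ('v \<Rightarrow> complex) \<Rightarrow> real" where
  "L2_norm S f = sqrt (\<Sum>\<^sub>\<infinity>v\<in>S. (cmod (f v))\<^sup>2)"

subsection \<open>The Laplacian\<close>

definition laplacian ::
  "'v set \<Rightarrow> ('v \<Rightarrow> 'v \<Rightarrow> real) \<Rightarrow> ('v \<Rightarrow> complex) \<Rightarrow> ('v \<Rightarrow> complex)" where
  "laplacian S w f =
     (\<lambda>v. if v \<in> S then \<Sum>\<^sub>\<infinity>u\<in>S. (f v - f u) * of_real (w v u) else 0)"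

text \<open>The Laplacian is self-adjoint, so all its eigenvalues are real.\<close>

definition laplacian_eigenvalue :: "'v set \<Rightarrow> ('v \<Rightarrow> 'v \<Rightarrow> real) \<Rightarrow> real \<Rightarrow> bool" where
  "laplacian_eigenvalue S w l \<longleftrightarrow>
     (\<exists>f\<in>L2 S. f \<noteq> (\<lambda>v. 0) \<and> laplacian S w f = (\<lambda>v. of_real l * f v))"

text \<open>Intended for finite \<open>S\<close> (finitely many eigenvalues, all non-negative) carrying at least
  one edge (so that a nonzero eigenvalue exists).\<close>

definition first_nonzero_eigenvalue :: "'v set \<Rightarrow> ('v \<Rightarrow> 'v \<Rightarrow> real) \<Rightarrow> real" where
  "first_nonzero_eigenvalue S w = Min {l. laplacian_eigenvalue S w l \<and> l \<noteq> 0}"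

subsection \<open>Spectral projectors and Paley-Wiener spaces\<close>

definition orthogonal_projector ::
  "'v set \<Rightarrow> (('v \<Rightarrow> complex) \<Rightarrow> ('v \<Rightarrow> complex)) \<Rightarrow> bool" where
  "orthogonal_projector S P \<longleftrightarrow>
     (\<forall>f\<in>L2 S. P f \<in> L2 S) \<and>
     (\<forall>f\<in>L2 S. \<forall>g\<in>L2 S. P (\<lambda>v. f v + g v) = (\<lambda>v. P f v + P g v)) \<and>
     (\<forall>c. \<forall>f\<in>L2 S. P (\<lambda>v. c * f v) = (\<lambda>v. c * P f v)) \<and>
     (\<forall>f\<in>L2 S. P (P f) = P f) \<and>
     (\<forall>f\<in>L2 S. \<forall>g\<in>L2 S. L2_inner S (P f) g = L2_inner S f (P g))"

text \<open>Projection-valued Borel measures on the real line.\<close>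

definition projection_valued_measure ::
  "'v set \<Rightarrow> (real set \<Rightarrow> ('v \<Rightarrow> complex) \<Rightarrow> ('v \<Rightarrow> complex)) \<Rightarrow> bool" where
  "projection_valued_measure S E \<longleftrightarrow>
     (\<forall>B\<in>sets borel. orthogonal_projector S (E B)) \<and>
     (\<forall>f\<in>L2 S. E UNIV f = f) \<and>
     (\<forall>B\<in>sets borel. \<forall>C\<in>sets borel. \<forall>f\<in>L2 S. E (B \<inter> C) f = E B (E C f)) \<and>
     (\<forall>B :: nat \<Rightarrow> real set. range B \<subseteq> sets borel \<longrightarrow> disjoint_family B \<longrightarrow>
        (\<forall>f\<in>L2 S. \<forall>g\<in>L2 S.
           (\<lambda>n. L2_inner S (E (B n) f) g) sums L2_inner S (E (\<Union>n. B n) f) g))"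

definition scalar_spectral_measure ::
  "'v set \<Rightarrow> (real set \<Rightarrow> ('v \<Rightarrow> complex) \<Rightarrow> ('v \<Rightarrow> complex)) \<Rightarrow> ('v \<Rightarrow> complex) \<Rightarrow> real measure"
where
  "scalar_spectral_measure S E f =
     measure_of UNIV (sets borel) (\<lambda>B. ennreal (Re (L2_inner S (E B f) f)))"

text \<open>\<open>E\<close> is the spectral measure of the bounded self-adjoint operator \<open>A\<close>: it has bounded
  support and \<open>A = \<integral> x dE(x)\<close>, expressed through the quadratic forms, which determine
  \<open>A\<close> by polarization.\<close>

definition spectral_measure_of ::
  "'v set \<Rightarrow> (('v \<Rightarrow> complex) \<Rightarrow> ('v \<Rightarrow> complex)) \<Rightarrow>
   (real set \<Rightarrow> ('v \<Rightarrow> complex) \<Rightarrow> ('v \<Rightarrow> complex)) \<Rightarrow> bool" where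
  "spectral_measure_of S A E \<longleftrightarrow>
     projection_valued_measure S E \<and>
     (\<exists>R. \<forall>f\<in>L2 S. E {-R..R} f = f) \<and>
     (\<forall>f\<in>L2 S. L2_inner S (A f) f = of_real (\<integral>x. x \<partial>scalar_spectral_measure S E f))"

text \<open>The range of the spectral projector \<open>E {0..\<omega>}\<close> of the Laplacian.  By the spectral theorem
  there is an \<open>E\<close> as below, and its action on \<open>L2 V\<close> is unique.\<close>

definition paley_wiener :: "'v set \<Rightarrow> ('v \<Rightarrow> 'v \<Rightarrow> real) \<Rightarrow> real \<Rightarrow> ('v \<Rightarrow> complex) set" where
  "paley_wiener V w \<omega> =
     {f. \<exists>E. spectral_measure_of V (laplacian V w) E \<and> f \<in> E {0..\<omega>} ` L2 V}"

subsection \<open>Frames\<close>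

definition frame_of_functionals ::
  "'v set \<Rightarrow> ('v \<Rightarrow> complex) set \<Rightarrow> 'j set \<Rightarrow> ('j \<Rightarrow> ('v \<Rightarrow> complex) \<Rightarrow> complex) \<Rightarrow> bool" where
  "frame_of_functionals V H J \<phi> \<longleftrightarrow>
     (\<exists>a b. 0 < a \<and> 0 < b \<and>
        (\<forall>f\<in>H. (\<lambda>j. (cmod (\<phi> j f))\<^sup>2) summable_on J \<and>
           a * (L2_norm V f)\<^sup>2 \<le> (\<Sum>\<^sub>\<infinity>j\<in>J. (cmod (\<phi> j f))\<^sup>2) \<and>
           (\<Sum>\<^sub>\<infinity>j\<in>J. (cmod (\<phi> j f))\<^sup>2) \<le> b * (L2_norm V f)\<^sup>2))"

definition normalized_indicator :: "'v set \<Rightarrow> 'v \<Rightarrow> complex" where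
  "normalized_indicator S = (\<lambda>v. of_real (indicator S v / sqrt (card S)))"

end

theory Submission
  imports Defs
begin

text \<open>Write \<open>a\<^sub>j = |\<langle>f, \<xi>\<^sub>j\<rangle>|\<^sup>2\<close>, and let \<open>b\<^sub>j\<close> and \<open>e\<^sub>j\<close> be the squared norm and the Dirichlet
  energy of \<open>f\<close> on \<open>\<Omega>\<^sub>j\<close>.  Then \<open>b\<^sub>j - a\<^sub>j\<close> is the squared distance of \<open>f\<close> from its mean on \<open>\<Omega>\<^sub>j\<close>, so
  \<open>\<Lambda> (b\<^sub>j - a\<^sub>j) \<le> e\<^sub>j\<close> by the variational characterisation of the first nonzero eigenvalue.
  Summing over \<open>j\<close> drops only the non-negative energy of the edges between different blocks, and
  the total energy of \<open>f\<close> is \<open>\<langle>\<L>f, f\<rangle> \<le> \<omega> \<parallel>f\<parallel>\<^sup>2\<close>.  Hence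
  \<open>(1 - \<omega>/\<Lambda>) \<parallel>f\<parallel>\<^sup>2 \<le> \<Sum>\<^sub>j a\<^sub>j\<close>, and the constant \<open>(1 - \<gamma>)/(1 + \<alpha>)\<close> is at most
  \<open>1 - \<omega>/\<Lambda>\<close>.\<close>

subsection \<open>The spectral gap of a finite connected graph\<close>

text \<open>The Dirichlet form. Every edge occurs as two ordered pairs, whence the division by 2. It
  is kept bilinear, so that first variations can be expressed, and real, since complex functions are
  later split into real and imaginary parts.\<close>

definition energy_form :: "'v set \<Rightarrow> ('v \<Rightarrow> 'v \<Rightarrow> real) \<Rightarrow> ('v \<Rightarrow> real) \<Rightarrow> ('v \<Rightarrow> real) \<Rightarrow> real" where
  "energy_form S w g h = (\<Sum>u\<in>S. \<Sum>v\<in>S. w u v * ((g u - g v) * (h u - h v))) / 2"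

text \<open>Summation by parts: split \<open>h u - h v\<close> into two sums and rename the
  variables in the second; symmetry of \<open>w\<close> makes the halves equal.\<close>

lemma energy_form_eq_laplacian:
  assumes sym: "\<And>u v. u \<in> S \<Longrightarrow> v \<in> S \<Longrightarrow> w u v = w v u"
  shows "energy_form S w g h = (\<Sum>u\<in>S. (\<Sum>v\<in>S. (g u - g v) * w u v) * h u)"
proof -
  have "(\<Sum>u\<in>S. \<Sum>v\<in>S. w u v * ((g u - g v) * (h u - h v))) =
      (\<Sum>u\<in>S. \<Sum>v\<in>S. (g u - g v) * w u v * h u) + (\<Sum>u\<in>S. \<Sum>v\<in>S. (g v - g u) * w u v * h v)"
    by (simp add: sum.distrib [symmetric] algebra_simps)
  also have "(\<Sum>u\<in>S. \<Sum>v\<in>S. (g v - g u) * w u v * h v) = (\<Sum>u\<in>S. \<Sum>v\<in>S. (g u - g v) * w u v * h u)"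
    by (subst sum.swap) (simp add: sym cong: sum.cong)
  finally show ?thesis
    by (simp add: energy_form_def sum_distrib_right)
qed

lemma energy_form_commute: "energy_form S w g h = energy_form S w h g"
  by (simp add: energy_form_def mult.commute)

lemma energy_form_nonneg:
  assumes "\<And>u v. u \<in> S \<Longrightarrow> v \<in> S \<Longrightarrow> 0 \<le> w u v"
  shows "0 \<le> energy_form S w g g"
  using assms by (simp add: energy_form_def sum_nonneg)

lemma energy_form_add_scaled:
  "energy_form S w (\<lambda>v. g v + t * h v) (\<lambda>v. g v + t * h v) =
     energy_form S w g g + 2 * t * energy_form S w g h + t\<^sup>2 * energy_form S w h h"
proof -
  have "(\<Sum>u\<in>S. \<Sum>v\<in>S. w u v *
        ((g u + t * h u - (g v + t * h v)) * (g u + t * h u - (g v + t * h v)))) =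
      (\<Sum>u\<in>S. \<Sum>v\<in>S. w u v * ((g u - g v) * (g u - g v))) +
      2 * t * (\<Sum>u\<in>S. \<Sum>v\<in>S. w u v * ((g u - g v) * (h u - h v))) +
      t\<^sup>2 * (\<Sum>u\<in>S. \<Sum>v\<in>S. w u v * ((h u - h v) * (h u - h v)))"
    unfolding sum_distrib_left sum.distrib [symmetric]
    by (intro sum.cong refl) (simp add: power2_eq_square algebra_simps)
  then show ?thesis
    by (simp add: energy_form_def add_divide_distrib)
qed

lemma energy_form_diff_const:
  "energy_form S w (\<lambda>v. g v - c) (\<lambda>v. h v - d) = energy_form S w g h"
  by (simp add: energy_form_def)

lemma energy_form_scale:
  "energy_form S w (\<lambda>v. t * g v) (\<lambda>v. t * g v) = t\<^sup>2 * energy_form S w g g"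
  using energy_form_add_scaled [of S w "\<lambda>_. 0" t g] by (simp add: energy_form_def)

section \<open>Real eigenvectors and finiteness of the spectrum\<close>

text \<open>The weights and \<open>l\<close> are real, so the real and imaginary parts of an
  eigenvector satisfy the same equation, and one of them is nonzero. This reduces the spectral
  questions to real functions and finite sums.\<close>

lemma laplacian_eigenvalue_iff_real:
  assumes "finite S"
  shows "laplacian_eigenvalue S w l \<longleftrightarrow>
    (\<exists>g. (\<Sum>v\<in>S. (g v)\<^sup>2) = 1 \<and> (\<forall>u\<in>S. (\<Sum>v\<in>S. (g u - g v) * w u v) = l * g u))"
    (is "?L \<longleftrightarrow> ?R")
proof
  assume ?L
  then obtain f where f: "f \<in> L2 S" "f \<noteq> (\<lambda>v. 0)" "laplacian S w f = (\<lambda>v. of_real l * f v)"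
    unfolding laplacian_eigenvalue_def by blast
  have eq: "(\<Sum>v\<in>S. (f u - f v) * of_real (w u v)) = of_real l * f u" if "u \<in> S" for u
    using fun_cong [OF f(3), of u] that assms by (simp add: laplacian_def)
  have re: "(\<Sum>v\<in>S. (Re (f u) - Re (f v)) * w u v) = l * Re (f u)" if "u \<in> S" for u
    using arg_cong [OF eq [OF that], of Re] by simp
  have im: "(\<Sum>v\<in>S. (Im (f u) - Im (f v)) * w u v) = l * Im (f u)" if "u \<in> S" for u
    using arg_cong [OF eq [OF that], of Im] by simp
  obtain x where x: "f x \<noteq> 0"
    using f(2) by blast
  with f(1) have "x \<in> S"
    by (auto simp: L2_def)
  have "\<exists>g. g x \<noteq> 0 \<and> (\<forall>u\<in>S. (\<Sum>v\<in>S. (g u - g v) * w u v) = l * g u)"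
  proof (cases "Re (f x) = 0")
    case True
    with x have "Im (f x) \<noteq> 0"
      by (simp add: complex_eq_iff)
    with im show ?thesis
      by (intro exI [of _ "\<lambda>v. Im (f v)"]) simp
  next
    case False
    with re show ?thesis
      by (intro exI [of _ "\<lambda>v. Re (f v)"]) simp
  qed
  then obtain g where g: "g x \<noteq> 0" "\<And>u. u \<in> S \<Longrightarrow> (\<Sum>v\<in>S. (g u - g v) * w u v) = l * g u"
    by blast
  define N where "N = (\<Sum>v\<in>S. (g v)\<^sup>2)"
  have "0 < N"
    unfolding N_def using g(1) \<open>x \<in> S\<close> assms by (intro sum_pos2 [of _ x]) auto
  show ?R
  proof (intro exI conjI ballI)
    show "(\<Sum>v\<in>S. (g v / sqrt N)\<^sup>2) = 1"
      using \<open>0 < N\<close> by (simp add: power_divide sum_divide_distrib [symmetric] N_def [symmetric])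
    fix u assume "u \<in> S"
    have "(\<Sum>v\<in>S. (g u / sqrt N - g v / sqrt N) * w u v) = (\<Sum>v\<in>S. (g u - g v) * w u v) / sqrt N"
      by (simp add: sum_divide_distrib diff_divide_distrib left_diff_distrib)
    then show "(\<Sum>v\<in>S. (g u / sqrt N - g v / sqrt N) * w u v) = l * (g u / sqrt N)"
      using g(2) [OF \<open>u \<in> S\<close>] by simp
  qed
next
  assume ?R
  then obtain g where g: "(\<Sum>v\<in>S. (g v)\<^sup>2) = 1"
    "\<And>u. u \<in> S \<Longrightarrow> (\<Sum>v\<in>S. (g u - g v) * w u v) = l * g u"
    by blast
  define f where "f = (\<lambda>v. if v \<in> S then complex_of_real (g v) else 0)"
  have "f \<in> L2 S"
    using assms by (auto simp: f_def L2_def)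
  moreover have "f \<noteq> (\<lambda>v. 0)"
  proof
    assume "f = (\<lambda>v. 0)"
    then have "\<forall>v\<in>S. g v = 0"
      by (metis f_def of_real_eq_0_iff)
    with g(1) show False
      by simp
  qed
  moreover have "laplacian S w f = (\<lambda>v. of_real l * f v)"
  proof
    fix u
    show "laplacian S w f u = of_real l * f u"
    proof (cases "u \<in> S")
      case True
      have "laplacian S w f u = of_real (\<Sum>v\<in>S. (g u - g v) * w u v)"
        using True assms by (simp add: laplacian_def f_def)
      with g(2) [OF True] True show ?thesis
        by (simp add: f_def)
    qed (simp add: laplacian_def f_def)
  qed
  ultimately show ?L
    unfolding laplacian_eigenvalue_def by blast
qed

text \<open>Bessel's inequality for the point masses, summed over all points, bounds the number of
  elements of an orthonormal family by the cardinality of \<open>S\<close>.\<close>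

lemma card_orthonormal_le:
  fixes g :: "'i \<Rightarrow> 'v \<Rightarrow> real"
  assumes "finite S" "finite A"
    and on: "\<And>i j. i \<in> A \<Longrightarrow> j \<in> A \<Longrightarrow> (\<Sum>v\<in>S. g i v * g j v) = (if i = j then 1 else 0)"
  shows "card A \<le> card S"
proof -
  have bessel: "(\<Sum>i\<in>A. (g i x)\<^sup>2) \<le> 1" if "x \<in> S" for x
  proof -
    \<comment> \<open>\<open>p\<close> is the orthogonal projection of the point mass at
      \<open>x\<close> onto the span of the family, so its squared norm equals its value at
      \<open>x\<close>.\<close>
    define p where "p v = (\<Sum>i\<in>A. g i x * g i v)" for v
    have px: "p x = (\<Sum>i\<in>A. (g i x)\<^sup>2)"
      by (simp add: p_def power2_eq_square)
    have "(\<Sum>v\<in>S. (p v)\<^sup>2) = (\<Sum>v\<in>S. \<Sum>i\<in>A. \<Sum>j\<in>A. (g i x * g j x) * (g i v * g j v))"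
      by (simp add: p_def power2_eq_square sum_product mult_ac)
    also have "\<dots> = (\<Sum>i\<in>A. \<Sum>v\<in>S. \<Sum>j\<in>A. (g i x * g j x) * (g i v * g j v))"
      by (rule sum.swap)
    also have "\<dots> = (\<Sum>i\<in>A. \<Sum>j\<in>A. \<Sum>v\<in>S. (g i x * g j x) * (g i v * g j v))"
      by (intro sum.cong refl sum.swap)
    also have "\<dots> = (\<Sum>i\<in>A. \<Sum>j\<in>A. (g i x * g j x) * (if i = j then 1 else 0))"
      by (intro sum.cong refl) (simp only: sum_distrib_left [symmetric] on)
    also have "\<dots> = p x"
      using \<open>finite A\<close> by (simp add: px power2_eq_square if_distrib cong: if_cong)
    finally have sq: "(\<Sum>v\<in>S. (p v)\<^sup>2) = p x" .
    \<comment> \<open>The squared distance from the point mass to \<open>p\<close> is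
      \<open>1 - p x\<close>.\<close>
    have "0 \<le> (\<Sum>v\<in>S. (of_bool (v = x) - p v)\<^sup>2)"
      by (intro sum_nonneg) simp
    also have "\<dots> = (\<Sum>v\<in>S. (if v = x then 1 - 2 * p v else 0) + (p v)\<^sup>2)"
      by (intro sum.cong refl) (simp add: power2_eq_square algebra_simps)
    also have "\<dots> = 1 - p x"
      using that \<open>finite S\<close> by (simp add: sum.distrib sq)
    finally show ?thesis
      by (simp add: px)
  qed
  have "real (card A) = (\<Sum>i\<in>A. \<Sum>v\<in>S. (g i v)\<^sup>2)"
    using on by (simp add: power2_eq_square)
  also have "\<dots> = (\<Sum>v\<in>S. \<Sum>i\<in>A. (g i v)\<^sup>2)"
    by (rule sum.swap)
  also have "\<dots> \<le> (\<Sum>v\<in>S. 1)"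
    by (intro sum_mono bessel)
  finally show ?thesis
    by simp
qed

text \<open>Unit eigenvectors for distinct eigenvalues are orthonormal, so there are at most
  \<open>card S\<close> eigenvalues. The \<open>Min\<close> in
  \<open>first_nonzero_eigenvalue\<close> is meaningful only because of this.\<close>

lemma finite_laplacian_eigenvalues:
  assumes "finite S" and sym: "\<And>u v. u \<in> S \<Longrightarrow> v \<in> S \<Longrightarrow> w u v = w v u"
  shows "finite {l. laplacian_eigenvalue S w l}"
proof -
  define g where "g l = (SOME g. (\<Sum>v\<in>S. (g v)\<^sup>2) = 1 \<and>
      (\<forall>u\<in>S. (\<Sum>v\<in>S. (g u - g v) * w u v) = l * g u))" for l
  have g: "(\<Sum>v\<in>S. (g l v)\<^sup>2) = 1 \<and> (\<forall>u\<in>S. (\<Sum>v\<in>S. (g l u - g l v) * w u v) = l * g l u)"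
    if "laplacian_eigenvalue S w l" for l
    unfolding g_def by (rule someI_ex [OF laplacian_eigenvalue_iff_real [OF assms(1), THEN iffD1, OF that]])
  have energy: "energy_form S w (g l) h = l * (\<Sum>v\<in>S. g l v * h v)"
    if "laplacian_eigenvalue S w l" for l h
    using g [OF that] by (simp add: energy_form_eq_laplacian sym sum_distrib_left mult.assoc)
  have on: "(\<Sum>v\<in>S. g l v * g m v) = (if l = m then 1 else 0)"
    if "laplacian_eigenvalue S w l" "laplacian_eigenvalue S w m" for l m
  proof (cases "l = m")
    case True
    with g [OF that(1)] show ?thesis
      by (simp add: power2_eq_square)
  next
    case False
    \<comment> \<open>Both sides are the energy of the pair \<open>g l\<close>, \<open>g m\<close>,
      by symmetry of the form.\<close>
    have "l * (\<Sum>v\<in>S. g l v * g m v) = m * (\<Sum>v\<in>S. g m v * g l v)"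
      using energy [OF that(1), of "g m"] energy [OF that(2), of "g l"]
      by (simp add: energy_form_commute [of S w "g l"])
    with False show ?thesis
      by (simp add: mult.commute)
  qed
  have "card A \<le> card S" if "A \<subseteq> {l. laplacian_eigenvalue S w l}" "finite A" for A
    by (rule card_orthonormal_le [OF assms(1) that(2), of g]) (use that on in blast)
  then show ?thesis
    using finite_if_finite_subsets_card_bdd [of "{l. laplacian_eigenvalue S w l}"] by blast
qed

text \<open>The energy of a unit eigenvector is its eigenvalue.\<close>

lemma laplacian_eigenvalue_nonneg:
  assumes "finite S" and sym: "\<And>u v. u \<in> S \<Longrightarrow> v \<in> S \<Longrightarrow> w u v = w v u"
    and nonneg: "\<And>u v. u \<in> S \<Longrightarrow> v \<in> S \<Longrightarrow> 0 \<le> w u v"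
    and "laplacian_eigenvalue S w l"
  shows "0 \<le> l"
proof -
  obtain g where g: "(\<Sum>v\<in>S. (g v)\<^sup>2) = 1"
    "\<And>u. u \<in> S \<Longrightarrow> (\<Sum>v\<in>S. (g u - g v) * w u v) = l * g u"
    using assms(4) unfolding laplacian_eigenvalue_iff_real [OF assms(1)] by blast
  have "energy_form S w g g = l * (\<Sum>v\<in>S. (g v)\<^sup>2)"
    by (simp add: energy_form_eq_laplacian sym g(2) sum_distrib_left power2_eq_square mult.assoc)
  with energy_form_nonneg [of S w g, OF nonneg] g(1) show ?thesis
    by simp
qed

section \<open>The variational problem on mean-zero functions\<close>

text \<open>A vanishing sum of non-negative terms forces \<open>g\<close> to agree across every
  edge, and a path from \<open>u\<close> to \<open>v\<close> transports the equality.\<close>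

lemma energy_form_eq_0_imp_constant:
  assumes "finite S" and nonneg: "\<And>u v. u \<in> S \<Longrightarrow> v \<in> S \<Longrightarrow> 0 \<le> w u v"
    and "connected_graph S w" and "energy_form S w g g = 0" and "u \<in> S" "v \<in> S"
  shows "g u = g v"
proof -
  have "(\<Sum>u\<in>S. \<Sum>v\<in>S. w u v * ((g u - g v) * (g u - g v))) = 0"
    using assms(4) by (simp add: energy_form_def)
  then have 0: "w x y * ((g x - g y) * (g x - g y)) = 0" if "x \<in> S" "y \<in> S" for x y
    using that nonneg \<open>finite S\<close>
    by (subst (asm) sum_nonneg_eq_0_iff; force intro!: sum_nonneg simp: sum_nonneg_eq_0_iff)
  have "(u, v) \<in> (edges S w)\<^sup>*"
    using assms by (auto simp: connected_graph_def)
  then show ?thesis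
  proof induction
    case (step y z)
    with 0 [of y z] show ?case
      by (auto simp: edges_def)
  qed simp
qed

text \<open>A parabola through the origin that never becomes negative has slope zero there. This
  extracts the Euler-Lagrange equation from minimality.\<close>

lemma quadratic_nonneg_imp_linear_eq_0:
  fixes a b :: real
  assumes "\<And>t. 0 \<le> 2 * t * b + t\<^sup>2 * a"
  shows "b = 0"
proof (rule ccontr)
  assume "b \<noteq> 0"
  \<comment> \<open>A substitute for the vertex \<open>- b / a\<close> whose denominator is positive
    whatever the sign of \<open>a\<close>.\<close>
  define t where "t = - b / (\<bar>a\<bar> + 1)"
  have "(\<bar>a\<bar> + 1)\<^sup>2 * (2 * t * b + t\<^sup>2 * a) = b\<^sup>2 * (a - 2 * (\<bar>a\<bar> + 1))"
  proof -
    have "(\<bar>a\<bar> + 1) * t = - b"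
      by (simp add: t_def)
    then show ?thesis
      by algebra
  qed
  moreover have "0 \<le> (\<bar>a\<bar> + 1)\<^sup>2 * (2 * t * b + t\<^sup>2 * a)"
    using assms by (intro mult_nonneg_nonneg) auto
  moreover have "b\<^sup>2 * (a - 2 * (\<bar>a\<bar> + 1)) < 0"
    using \<open>b \<noteq> 0\<close> by (intro mult_pos_neg) auto
  ultimately show False
    by linarith
qed

text \<open>Courant--Fischer: the minimum of the energy over mean-zero unit vectors is attained, and
  the minimiser is an eigenvector.\<close>

lemma rayleigh_minimum_is_eigenvalue:
  fixes w :: "'v \<Rightarrow> 'v \<Rightarrow> real"
  assumes "finite S" "1 < card S" and sym: "\<And>u v. u \<in> S \<Longrightarrow> v \<in> S \<Longrightarrow> w u v = w v u"
    and nonneg: "\<And>u v. u \<in> S \<Longrightarrow> v \<in> S \<Longrightarrow> 0 \<le> w u v"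
    and "connected_graph S w"
  obtains m where "0 < m" "laplacian_eigenvalue S w m"
    "\<And>g. (\<Sum>v\<in>S. g v) = 0 \<Longrightarrow> m * (\<Sum>v\<in>S. (g v)\<^sup>2) \<le> energy_form S w g g"
proof -
  \<comment> \<open>Pinning the values off \<open>S\<close> to 0 makes \<open>B\<close> a product of
    compact sets, so Tychonoff's theorem applies even when the vertex type is infinite.\<close>
  define B :: "('v \<Rightarrow> real) set" where "B = PiE UNIV (\<lambda>v. if v \<in> S then {-1..1} else {0})"
  define K where "K = B \<inter> {g. (\<Sum>v\<in>S. (g v)\<^sup>2) = 1} \<inter> {g. (\<Sum>v\<in>S. g v) = 0}"
  have coord: "continuous_on X (\<lambda>g. g v)" for v and X :: "('v \<Rightarrow> real) set"
    by (rule continuous_on_subset [OF continuous_on_product_coordinates]) simp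
  have "compactin (product_topology (\<lambda>v. euclidean) UNIV) B"
    unfolding B_def by (subst compactin_PiE) auto
  then have "compact B"
    by (simp add: euclidean_product_topology)
  moreover have "closed {g. (\<Sum>v\<in>S. (g v)\<^sup>2) = (1::real)}" "closed {g. (\<Sum>v\<in>S. g v) = (0::real)}"
    by (intro closed_Collect_eq continuous_intros coord)+
  ultimately have "compact K"
    unfolding K_def by (intro compact_Int_closed)
  \<comment> \<open>Rescaling to unit norm divides the energy by the squared norm; cutting off
    outside \<open>S\<close> leaves it unchanged.\<close>
  have normalise: "\<exists>k\<in>K. energy_form S w k k = energy_form S w g g / (\<Sum>v\<in>S. (g v)\<^sup>2)"
    if g0: "(\<Sum>v\<in>S. g v) = 0" and pos: "0 < (\<Sum>v\<in>S. (g v)\<^sup>2)" for g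
  proof -
    define N where "N = (\<Sum>v\<in>S. (g v)\<^sup>2)"
    define h where "h v = (1 / sqrt N) * g v" for v
    define k where "k v = (if v \<in> S then h v else 0)" for v
    have N: "0 < N"
      using pos by (simp add: N_def)
    have sq: "(\<Sum>v\<in>S. (k v)\<^sup>2) = 1"
      using N by (simp add: k_def h_def power_divide sum_divide_distrib [symmetric] N_def [symmetric])
    have "(k v)\<^sup>2 \<le> 1" if "v \<in> S" for v
      using member_le_sum [of v S "\<lambda>v. (k v)\<^sup>2"] that \<open>finite S\<close> by (simp add: sq)
    then have "k \<in> B"
      by (auto simp: B_def k_def abs_square_le_1 abs_le_iff)
    moreover have "(\<Sum>v\<in>S. k v) = 0"
      using g0 by (simp add: k_def h_def sum_divide_distrib [symmetric])
    ultimately have "k \<in> K"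
      using sq by (simp add: K_def)
    moreover have "energy_form S w k k = energy_form S w h h"
      by (simp add: energy_form_def k_def)
    moreover have "\<dots> = energy_form S w g g / N"
      unfolding h_def energy_form_scale using N by (simp add: power_divide)
    ultimately show ?thesis
      unfolding N_def by force
  qed
  have "K \<noteq> {}"
  proof -
    obtain a b where ab: "a \<in> S" "b \<in> S" "a \<noteq> b"
      using assms(2) card_le_Suc0_iff_eq [OF assms(1)] by (metis One_nat_def not_less)
    \<comment> \<open>The difference of two point masses is mean-zero and nonzero; the two vertices
      exist because \<open>1 < card S\<close>.\<close>
    define g :: "'v \<Rightarrow> real" where "g v = of_bool (v = a) - of_bool (v = b)" for v
    have "(\<Sum>v\<in>S. g v) = 0"
      using ab \<open>finite S\<close> by (simp add: g_def sum_subtractf of_bool_def)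
    moreover have "0 < (\<Sum>v\<in>S. (g v)\<^sup>2)"
      using ab \<open>finite S\<close> by (intro sum_pos2 [of _ a]) (auto simp: g_def)
    ultimately show ?thesis
      using normalise by blast
  qed
  have "continuous_on K (\<lambda>g. energy_form S w g g)"
    unfolding energy_form_def by (intro continuous_intros coord) simp
  then obtain h where h: "h \<in> K" and min: "\<And>g. g \<in> K \<Longrightarrow> energy_form S w h h \<le> energy_form S w g g"
    using continuous_attains_inf [OF \<open>compact K\<close> \<open>K \<noteq> {}\<close>] by blast
  define m where "m = energy_form S w h h"
  have h1: "(\<Sum>v\<in>S. (h v)\<^sup>2) = 1" and h0: "(\<Sum>v\<in>S. h v) = 0"
    using h by (auto simp: K_def)
  have rayleigh: "m * (\<Sum>v\<in>S. (g v)\<^sup>2) \<le> energy_form S w g g" if "(\<Sum>v\<in>S. g v) = 0" for g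
  proof (cases "(\<Sum>v\<in>S. (g v)\<^sup>2) = 0")
    case True
    with energy_form_nonneg [of S w g, OF nonneg] show ?thesis
      by simp
  next
    case False
    then have pos: "0 < (\<Sum>v\<in>S. (g v)\<^sup>2)"
      by (simp add: less_le sum_nonneg)
    with normalise [OF that] min have "m \<le> energy_form S w g g / (\<Sum>v\<in>S. (g v)\<^sup>2)"
      unfolding m_def by force
    with pos show ?thesis
      by (simp add: field_simps)
  qed
  \<comment> \<open>First variation: \<open>h + t * g\<close> stays mean-zero, so energy minus
    \<open>m\<close> times squared norm is non-negative for every \<open>t\<close> and vanishes at
    \<open>t = 0\<close>.\<close>
  have ortho: "energy_form S w h g = m * (\<Sum>v\<in>S. h v * g v)" if g0: "(\<Sum>v\<in>S. g v) = 0" for g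
  proof -
    have "0 \<le> 2 * t * (energy_form S w h g - m * (\<Sum>v\<in>S. h v * g v)) +
        t\<^sup>2 * (energy_form S w g g - m * (\<Sum>v\<in>S. (g v)\<^sup>2))" for t
    proof -
      have "(\<Sum>v\<in>S. h v + t * g v) = 0"
        by (simp add: sum.distrib sum_distrib_left [symmetric] h0 g0)
      then have le: "m * (\<Sum>v\<in>S. (h v + t * g v)\<^sup>2) \<le>
          energy_form S w (\<lambda>v. h v + t * g v) (\<lambda>v. h v + t * g v)"
        by (rule rayleigh)
      have "(\<Sum>v\<in>S. (h v + t * g v)\<^sup>2) =
          (\<Sum>v\<in>S. (h v)\<^sup>2) + 2 * t * (\<Sum>v\<in>S. h v * g v) + t\<^sup>2 * (\<Sum>v\<in>S. (g v)\<^sup>2)"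
        by (simp add: sum.distrib [symmetric] sum_distrib_left power2_eq_square algebra_simps)
      with le show ?thesis
        by (simp add: energy_form_add_scaled h1 m_def [symmetric] algebra_simps)
    qed
    then have "energy_form S w h g - m * (\<Sum>v\<in>S. h v * g v) = 0"
      by (rule quadratic_nonneg_imp_linear_eq_0)
    then show ?thesis
      by simp
  qed
  have eigen: "(\<Sum>v\<in>S. (h u - h v) * w u v) = m * h u" if "u \<in> S" for u
  proof -
    define c where "c = 1 / real (card S)"
    \<comment> \<open>The test function is the point mass at \<open>u\<close> minus its mean
      \<open>c\<close>. The constant changes neither the energy nor, as \<open>h\<close> has mean
      zero, the pairing with \<open>h\<close>; thus the weak equation yields the pointwise
      one.\<close>
    define e :: "'v \<Rightarrow> real" where "e v = (if v = u then 1 else 0)" for v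
    have "S \<noteq> {}"
      using that by blast
    then have e0: "(\<Sum>v\<in>S. e v - c) = 0"
      using that \<open>finite S\<close> by (simp add: c_def e_def sum_subtractf)
    have "(\<Sum>v\<in>S. h v * e v) = h u"
      using that \<open>finite S\<close> by (simp add: e_def if_distrib cong: if_cong)
    then have "(\<Sum>v\<in>S. h v * (e v - c)) = h u"
      by (simp add: right_diff_distrib sum_subtractf sum_distrib_right [symmetric] h0)
    with ortho [OF e0] have "energy_form S w h (\<lambda>v. e v - c) = m * h u"
      by simp
    moreover have "energy_form S w h (\<lambda>v. e v - c) = energy_form S w h e"
      using energy_form_diff_const [of S w h 0 e c] by simp
    moreover have "energy_form S w h e = (\<Sum>x\<in>S. (\<Sum>v\<in>S. (h x - h v) * w x v) * e x)"
      by (rule energy_form_eq_laplacian [OF sym])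
    moreover have "\<dots> = (\<Sum>v\<in>S. (h u - h v) * w u v)"
      using that \<open>finite S\<close> by (simp add: e_def if_distrib cong: if_cong)
    ultimately show ?thesis
      by simp
  qed
  \<comment> \<open>Zero energy would make \<open>h\<close> constant by connectedness, hence zero by
    its mean, against its unit norm.\<close>
  have "m \<noteq> 0"
  proof
    assume "m = 0"
    then have const: "h u = h v" if "u \<in> S" "v \<in> S" for u v
      using energy_form_eq_0_imp_constant [of S w h u v, OF assms(1) nonneg assms(5)] that
      by (simp add: m_def)
    have "h u = 0" if "u \<in> S" for u
    proof -
      have "(\<Sum>v\<in>S. h v) = (\<Sum>v\<in>S. h u)"
        by (intro sum.cong refl const that)
      with h0 assms(2) show ?thesis
        by simp
    qed
    with h1 show False
      by simp
  qed
  moreover have "0 \<le> m"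
    unfolding m_def by (rule energy_form_nonneg [OF nonneg])
  ultimately have "0 < m"
    by simp
  moreover have "laplacian_eigenvalue S w m"
    unfolding laplacian_eigenvalue_iff_real [OF assms(1)] using h1 eigen by blast
  ultimately show ?thesis
    using that rayleigh by blast
qed

section \<open>The Poincare inequality on one block\<close>

lemma sum_square_diff_mean:
  fixes g :: "'v \<Rightarrow> real"
  assumes "finite S" "S \<noteq> {}"
  shows "(\<Sum>v\<in>S. (g v - (\<Sum>v\<in>S. g v) / card S)\<^sup>2) = (\<Sum>v\<in>S. (g v)\<^sup>2) - (\<Sum>v\<in>S. g v)\<^sup>2 / card S"
proof -
  define a where "a = (\<Sum>v\<in>S. g v) / card S"
  have a: "(\<Sum>v\<in>S. g v) = card S * a"
    using assms by (simp add: a_def)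
  have "(\<Sum>v\<in>S. (g v - a)\<^sup>2) = (\<Sum>v\<in>S. (g v)\<^sup>2) - 2 * a * (\<Sum>v\<in>S. g v) + card S * a\<^sup>2"
    by (simp add: power2_diff sum.distrib sum_subtractf sum_distrib_left [symmetric]
        sum_distrib_right [symmetric])
  also have "\<dots> = (\<Sum>v\<in>S. (g v)\<^sup>2) - card S * a\<^sup>2"
    by (simp add: a power2_eq_square)
  finally show ?thesis
    using assms by (simp add: a_def power2_eq_square)
qed

text \<open>Subtracting the mean leaves the energy unchanged and turns the squared norm into the
  variance, to which the Rayleigh bound applies. Real and imaginary parts are treated separately and
  added.\<close>

lemma first_nonzero_eigenvalue_poincare:
  fixes f :: "'v \<Rightarrow> complex"
  assumes "finite S" "1 < card S" and sym: "\<And>u v. u \<in> S \<Longrightarrow> v \<in> S \<Longrightarrow> w u v = w v u"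
    and nonneg: "\<And>u v. u \<in> S \<Longrightarrow> v \<in> S \<Longrightarrow> 0 \<le> w u v"
    and "connected_graph S w"
  shows first_nonzero_eigenvalue_nonneg: "0 \<le> first_nonzero_eigenvalue S w"
    and "first_nonzero_eigenvalue S w *
        ((\<Sum>v\<in>S. (cmod (f v))\<^sup>2) - (cmod (\<Sum>v\<in>S. f v))\<^sup>2 / card S)
      \<le> (\<Sum>u\<in>S. \<Sum>v\<in>S. w u v * (cmod (f u - f v))\<^sup>2) / 2"
proof -
  obtain m where m: "0 < m" "laplacian_eigenvalue S w m"
    "\<And>g. (\<Sum>v\<in>S. g v) = 0 \<Longrightarrow> m * (\<Sum>v\<in>S. (g v)\<^sup>2) \<le> energy_form S w g g"
    using rayleigh_minimum_is_eigenvalue [OF assms(1,2) sym nonneg assms(5)] by blast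
  let ?E = "{l. laplacian_eigenvalue S w l \<and> l \<noteq> 0}"
  have fin: "finite ?E"
    by (rule finite_subset [OF _ finite_laplacian_eigenvalues [of S w, OF assms(1) sym]]) auto
  have m_in: "m \<in> ?E"
    using m by simp
  then have "first_nonzero_eigenvalue S w \<in> ?E"
    unfolding first_nonzero_eigenvalue_def using Min_in [OF fin] by blast
  then show "0 \<le> first_nonzero_eigenvalue S w"
    using laplacian_eigenvalue_nonneg [of S w, OF assms(1) sym nonneg] by blast
  \<comment> \<open>The Rayleigh minimum is itself a nonzero eigenvalue, so the least of these lies
    below it.\<close>
  have le_m: "first_nonzero_eigenvalue S w \<le> m"
    unfolding first_nonzero_eigenvalue_def using fin m_in by (rule Min_le)
  have "S \<noteq> {}"
    using assms(2) by auto
  note var = sum_square_diff_mean [OF assms(1) this]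
  have real: "first_nonzero_eigenvalue S w * ((\<Sum>v\<in>S. (g v)\<^sup>2) - (\<Sum>v\<in>S. g v)\<^sup>2 / card S)
      \<le> energy_form S w g g" for g
  proof -
    let ?a = "(\<Sum>v\<in>S. g v) / card S"
    have "first_nonzero_eigenvalue S w * (\<Sum>v\<in>S. (g v - ?a)\<^sup>2) \<le> m * (\<Sum>v\<in>S. (g v - ?a)\<^sup>2)"
      by (intro mult_right_mono le_m sum_nonneg) simp
    also have "\<dots> \<le> energy_form S w (\<lambda>v. g v - ?a) (\<lambda>v. g v - ?a)"
      using assms(1,2) by (intro m(3)) (simp add: sum_subtractf)
    finally show ?thesis
      by (simp add: energy_form_diff_const var)
  qed
  have "(\<Sum>v\<in>S. (cmod (f v))\<^sup>2) - (cmod (\<Sum>v\<in>S. f v))\<^sup>2 / card S =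
      ((\<Sum>v\<in>S. (Re (f v))\<^sup>2) - (\<Sum>v\<in>S. Re (f v))\<^sup>2 / card S) +
      ((\<Sum>v\<in>S. (Im (f v))\<^sup>2) - (\<Sum>v\<in>S. Im (f v))\<^sup>2 / card S)"
    by (simp add: cmod_power2 sum.distrib add_divide_distrib)
  moreover have "(\<Sum>u\<in>S. \<Sum>v\<in>S. w u v * (cmod (f u - f v))\<^sup>2) / 2 =
      energy_form S w (\<lambda>v. Re (f v)) (\<lambda>v. Re (f v)) + energy_form S w (\<lambda>v. Im (f v)) (\<lambda>v. Im (f v))"
    by (simp add: energy_form_def cmod_power2 power2_eq_square [symmetric] sum.distrib distrib_left
        add_divide_distrib)
  ultimately show "first_nonzero_eigenvalue S w *
        ((\<Sum>v\<in>S. (cmod (f v))\<^sup>2) - (cmod (\<Sum>v\<in>S. f v))\<^sup>2 / card S)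
      \<le> (\<Sum>u\<in>S. \<Sum>v\<in>S. w u v * (cmod (f u - f v))\<^sup>2) / 2"
    using add_mono [OF real [of "\<lambda>v. Re (f v)"] real [of "\<lambda>v. Im (f v)"]]
    by (simp only: distrib_left)
qed

subsection \<open>Spectral measures and Paley-Wiener functions\<close>

lemma L2_inner_self:
  assumes "f \<in> L2 S"
  shows "L2_inner S f f = of_real ((L2_norm S f)\<^sup>2)"
proof -
  have "L2_inner S f f = (\<Sum>\<^sub>\<infinity>v\<in>S. of_real ((cmod (f v))\<^sup>2))"
    by (simp only: L2_inner_def complex_norm_square)
  also have "\<dots> = of_real (\<Sum>\<^sub>\<infinity>v\<in>S. (cmod (f v))\<^sup>2)"
    using assms by (intro infsumI has_sum_of_real has_sum_infsum) (simp add: L2_def)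
  finally show ?thesis
    by (simp add: L2_norm_def infsum_nonneg)
qed

lemma L2_norm_power2: "(L2_norm S f)\<^sup>2 = (\<Sum>\<^sub>\<infinity>v\<in>S. (cmod (f v))\<^sup>2)"
  by (simp add: L2_norm_def infsum_nonneg)

lemma orthogonal_projector_inner:
  assumes "orthogonal_projector S P" "f \<in> L2 S"
  shows "L2_inner S (P f) f = of_real ((L2_norm S (P f))\<^sup>2)"
proof -
  have "L2_inner S (P f) f = L2_inner S (P (P f)) f"
    using assms by (simp add: orthogonal_projector_def)
  also have "\<dots> = L2_inner S (P f) (P f)"
    using assms unfolding orthogonal_projector_def by blast
  also have "\<dots> = of_real ((L2_norm S (P f))\<^sup>2)"
    using assms by (intro L2_inner_self) (simp add: orthogonal_projector_def)
  finally show ?thesis .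
qed

section \<open>Scalar measures obtained from the projection-valued one\<close>

text \<open>Apply countable additivity to the constant sequence of empty sets: a constant series
  converges only if its term is 0.\<close>

lemma projection_valued_measure_empty:
  assumes "projection_valued_measure S E" "f \<in> L2 S" "g \<in> L2 S"
  shows "L2_inner S (E {} f) g = 0"
proof -
  have additive: "range B \<subseteq> sets borel \<Longrightarrow> disjoint_family B \<Longrightarrow>
      (\<lambda>n. L2_inner S (E (B n) f) g) sums L2_inner S (E (\<Union>n. B n) f) g" for B :: "nat \<Rightarrow> real set"
    using assms unfolding projection_valued_measure_def by blast
  have "summable (\<lambda>n::nat. L2_inner S (E {} f) g)"
    using additive [of "\<lambda>_. {}"] by (auto simp: disjoint_family_on_def sums_iff)
  then show ?thesis
    by (simp add: summable_const_iff)
qed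

text \<open>\<open>measure_of\<close> takes the prescribed values only for a positive, countably
  additive set function. Non-negativity holds because each value is the squared norm of a
  projection.\<close>

lemma
  assumes pvm: "projection_valued_measure S E" and f: "f \<in> L2 S"
  shows sets_scalar_spectral_measure: "sets (scalar_spectral_measure S E f) = sets borel"
    and space_scalar_spectral_measure: "space (scalar_spectral_measure S E f) = UNIV"
    and emeasure_scalar_spectral_measure: "B \<in> sets borel \<Longrightarrow>
      emeasure (scalar_spectral_measure S E f) B = ennreal ((L2_norm S (E B f))\<^sup>2)"
proof -
  have sa: "sigma_algebra UNIV (sets (borel :: real measure))"
    using sets.sigma_algebra_axioms [of "borel :: real measure"] by simp
  then show "sets (scalar_spectral_measure S E f) = sets borel"
    unfolding scalar_spectral_measure_def by (rule sigma_algebra.sets_measure_of_eq)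
  show "space (scalar_spectral_measure S E f) = UNIV"
    by (simp add: scalar_spectral_measure_def space_measure_of_conv)
  have inner: "L2_inner S (E B f) f = of_real ((L2_norm S (E B f))\<^sup>2)" if "B \<in> sets borel" for B
    using pvm f that by (intro orthogonal_projector_inner) (simp_all add: projection_valued_measure_def)
  let ?\<mu> = "\<lambda>B. ennreal (Re (L2_inner S (E B f) f))"
  have "positive (sets borel) ?\<mu>"
    by (simp add: positive_def projection_valued_measure_empty [OF pvm f f])
  moreover have "countably_additive (sets borel) ?\<mu>"
    unfolding countably_additive_def
  proof (intro allI impI)
    fix B :: "nat \<Rightarrow> real set"
    assume B: "range B \<subseteq> sets borel" "disjoint_family B"
    then have "(\<lambda>n. L2_inner S (E (B n) f) f) sums L2_inner S (E (\<Union>n. B n) f) f"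
      using pvm f unfolding projection_valued_measure_def by blast
    then have "(\<lambda>n. Re (L2_inner S (E (B n) f) f)) sums Re (L2_inner S (E (\<Union>n. B n) f) f)"
      by (rule sums_Re)
    moreover have "0 \<le> Re (L2_inner S (E (B n) f) f)" for n
      using B inner [of "B n"] by (simp add: range_subsetD)
    ultimately show "(\<Sum>n. ?\<mu> (B n)) = ?\<mu> (\<Union>n. B n)"
      by (intro suminf_ennreal_eq)
  qed
  ultimately show "emeasure (scalar_spectral_measure S E f) B = ennreal ((L2_norm S (E B f))\<^sup>2)"
    if "B \<in> sets borel"
    unfolding scalar_spectral_measure_def
    by (subst emeasure_measure_of_sigma [OF sa]) (simp_all add: that inner)
qed

lemma paley_wiener_subset_L2: "paley_wiener V w \<omega> \<subseteq> L2 V"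
  by (force simp: paley_wiener_def spectral_measure_of_def projection_valued_measure_def
      orthogonal_projector_def)

text \<open>The scalar spectral measure of \<open>f\<close> has total mass
  \<open>(L2_norm V f)\<^sup>2\<close> and is concentrated on \<open>{0..\<omega>}\<close>, so the
  integral of \<open>x\<close> is at most \<omega> times that mass.\<close>

lemma paley_wiener_laplacian_form_le:
  assumes "f \<in> paley_wiener V w \<omega>"
  shows "Re (L2_inner V (laplacian V w f) f) \<le> \<omega> * (L2_norm V f)\<^sup>2"
proof -
  obtain E g where E: "spectral_measure_of V (laplacian V w) E" and g: "g \<in> L2 V"
    and fg: "f = E {0..\<omega>} g"
    using assms by (auto simp: paley_wiener_def)
  have f: "f \<in> L2 V"
    using assms paley_wiener_subset_L2 by blast
  have pvm: "projection_valued_measure V E"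
    using E by (simp add: spectral_measure_of_def)
  let ?M = "scalar_spectral_measure V E f"
  note sets_M = sets_scalar_spectral_measure [OF pvm f]
    and space_M = space_scalar_spectral_measure [OF pvm f]
    and emeasure_M = emeasure_scalar_spectral_measure [OF pvm f]
  have emeasure_UNIV: "emeasure ?M UNIV = ennreal ((L2_norm V f)\<^sup>2)"
    using pvm f by (simp add: emeasure_M projection_valued_measure_def)
  interpret finite_measure ?M
    by standard (simp add: space_M emeasure_UNIV)
  \<comment> \<open>Multiplicativity on the disjoint sets \<open>- {0..\<omega>}\<close> and
    \<open>{0..\<omega>}\<close> shows that the complement carries no mass.\<close>
  have "E (B \<inter> C) g = E B (E C g)" if "B \<in> sets borel" "C \<in> sets borel" for B C
    using pvm g that unfolding projection_valued_measure_def by blast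
  from this [of "- {0..\<omega>}" "{0..\<omega>}"] have "E (- {0..\<omega>}) f = E {} g"
    by (simp add: fg Compl_disjoint2)
  moreover have "L2_norm V (E {} g) = 0"
  proof -
    have "orthogonal_projector V (E {})"
      using pvm by (simp add: projection_valued_measure_def)
    from orthogonal_projector_inner [OF this g] projection_valued_measure_empty [OF pvm g g]
    show ?thesis
      by simp
  qed
  ultimately have "emeasure ?M (- {0..\<omega>}) = 0"
    by (simp add: emeasure_M)
  then have "- {0..\<omega>} \<in> null_sets ?M"
    by (simp add: null_sets_def sets_M)
  then have AE: "AE x in ?M. x \<in> {0..\<omega>}"
    by (rule AE_I') auto
  have meas: "(\<lambda>x. x) \<in> borel_measurable ?M"
    by (simp add: measurable_cong_sets [OF sets_M refl])
  have "integrable ?M (\<lambda>x. x)"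
    using AE by (intro integrable_const_bound [of _ \<omega>] meas) (auto elim: eventually_mono)
  then have "(\<integral>x. x \<partial>?M) \<le> (\<integral>x. \<omega> \<partial>?M)"
    using AE by (intro integral_mono_AE) (auto elim: eventually_mono)
  also have "\<dots> = \<omega> * (L2_norm V f)\<^sup>2"
    by (simp add: space_M measure_def emeasure_UNIV)
  finally show ?thesis
    using E f by (simp add: spectral_measure_of_def)
qed

subsection \<open>Energy decomposition over the blocks\<close>

text \<open>The definition bounds the degrees only for infinite \<open>V\<close>; for finite
  \<open>V\<close> the largest degree serves. Symmetry moves the summation to the second argument of
  \<open>w\<close>, as in \<open>laplacian\<close>.\<close>

lemma weighted_graph_degrees:
  assumes "weighted_graph V w"
  obtains c where "\<And>v. v \<in> V \<Longrightarrow> (\<lambda>u. w v u) summable_on V"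
    "\<And>v. v \<in> V \<Longrightarrow> (\<Sum>\<^sub>\<infinity>u\<in>V. w v u) \<le> c"
proof -
  have "\<exists>c. \<forall>v\<in>V. (\<lambda>u. w u v) summable_on V \<and> (\<Sum>\<^sub>\<infinity>u\<in>V. w u v) \<le> c"
  proof (cases "finite V")
    case True
    then show ?thesis
      by (intro exI [of _ "Max ((\<lambda>v. \<Sum>\<^sub>\<infinity>u\<in>V. w u v) ` V)"]) auto
  next
    case False
    with assms show ?thesis
      by (simp add: weighted_graph_def)
  qed
  then obtain c where c: "\<forall>v\<in>V. (\<lambda>u. w u v) summable_on V \<and> (\<Sum>\<^sub>\<infinity>u\<in>V. w u v) \<le> c" ..
  have sym: "w v u = w u v" if "u \<in> V" "v \<in> V" for u v
    using assms that by (auto simp: weighted_graph_def)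
  have "(\<lambda>u. w v u) summable_on V" "(\<Sum>\<^sub>\<infinity>u\<in>V. w v u) \<le> c" if "v \<in> V" for v
  proof -
    have "(\<lambda>u. w v u) summable_on V \<longleftrightarrow> (\<lambda>u. w u v) summable_on V"
      by (rule summable_on_cong) (rule sym [OF _ that])
    moreover have "(\<Sum>\<^sub>\<infinity>u\<in>V. w v u) = (\<Sum>\<^sub>\<infinity>u\<in>V. w u v)"
      by (rule infsum_cong) (rule sym [OF _ that])
    ultimately show "(\<lambda>u. w v u) summable_on V" "(\<Sum>\<^sub>\<infinity>u\<in>V. w v u) \<le> c"
      using c that by auto
  qed
  with that show ?thesis
    by blast
qed

text \<open>Summation by parts on a possibly infinite graph. Bounded degrees make the double series
  of \<open>F\<close> absolutely convergent, so it can be summed iteratively and symmetrised in its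
  two variables. The factor 2 reflects ordered pairs.\<close>

lemma laplacian_form_has_sum:
  assumes wg: "weighted_graph V w" and f: "f \<in> L2 V"
  shows "((\<lambda>(v, u). w v u * (cmod (f v - f u))\<^sup>2) has_sum
    2 * Re (L2_inner V (laplacian V w f) f)) (V \<times> V)"
proof -
  obtain c where w_sum: "\<And>v. v \<in> V \<Longrightarrow> (\<lambda>u. w v u) summable_on V"
    and w_le: "\<And>v. v \<in> V \<Longrightarrow> (\<Sum>\<^sub>\<infinity>u\<in>V. w v u) \<le> c"
    using weighted_graph_degrees [OF wg] by blast
  have sym: "w v u = w u v" and nonneg: "0 \<le> w u v" if "u \<in> V" "v \<in> V" for u v
    using wg that by (auto simp: weighted_graph_def)
  have "(\<lambda>v. (\<Sum>\<^sub>\<infinity>u\<in>V. w v u) * (cmod (f v))\<^sup>2) summable_on V"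
  proof (rule summable_on_comparison_test)
    show "(\<lambda>v. c * (cmod (f v))\<^sup>2) summable_on V"
      using f by (intro summable_on_cmult_right) (simp add: L2_def)
  qed (auto intro!: mult_right_mono mult_nonneg_nonneg infsum_nonneg w_le nonneg)
  then have "(\<lambda>(v, u). w v u * (cmod (f v))\<^sup>2) summable_on V \<times> V"
    by (intro summable_on_SigmaI [where g = "\<lambda>v. (\<Sum>\<^sub>\<infinity>u\<in>V. w v u) * (cmod (f v))\<^sup>2"])
      (auto intro!: has_sum_cmult_left has_sum_infsum w_sum mult_nonneg_nonneg nonneg)
  moreover from this have "(\<lambda>(v, u). w v u * (cmod (f u))\<^sup>2) summable_on V \<times> V"
    by (subst summable_on_swap) (auto simp: sym elim!: summable_on_cong [THEN iffD1, rotated])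
  ultimately have dom:
    "(\<lambda>p. 2 * (case p of (v, u) \<Rightarrow> w v u * (cmod (f v))\<^sup>2) +
        (case p of (v, u) \<Rightarrow> w v u * (cmod (f u))\<^sup>2)) summable_on V \<times> V"
    by (intro summable_on_add summable_on_cmult_right)
  define F where "F = (\<lambda>(v, u). (f v - f u) * of_real (w v u) * cnj (f v))"
  have "norm (F (v, u)) \<le> 2 * (w v u * (cmod (f v))\<^sup>2) + w v u * (cmod (f u))\<^sup>2"
    if "v \<in> V" "u \<in> V" for v u
  proof -
    have "cmod (f v - f u) * cmod (f v) \<le> (cmod (f v) + cmod (f u)) * cmod (f v)"
      by (intro mult_right_mono norm_triangle_ineq4) simp
    also have "\<dots> \<le> 2 * (cmod (f v))\<^sup>2 + (cmod (f u))\<^sup>2"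
    proof -
      \<comment> \<open>The difference is exhibited as a sum of squares.\<close>
      have "2 * (cmod (f v))\<^sup>2 + (cmod (f u))\<^sup>2 - (cmod (f v) + cmod (f u)) * cmod (f v) =
          ((cmod (f v) - cmod (f u))\<^sup>2 + (cmod (f v))\<^sup>2 + (cmod (f u))\<^sup>2) / 2"
        by (simp add: power2_eq_square field_simps)
      moreover have "0 \<le> ((cmod (f v) - cmod (f u))\<^sup>2 + (cmod (f v))\<^sup>2 + (cmod (f u))\<^sup>2) / 2"
        by simp
      ultimately show ?thesis
        by linarith
    qed
    finally have "w v u * (cmod (f v - f u) * cmod (f v)) \<le>
        w v u * (2 * (cmod (f v))\<^sup>2 + (cmod (f u))\<^sup>2)"
      using that by (intro mult_left_mono nonneg)
    moreover have "norm (F (v, u)) = w v u * (cmod (f v - f u) * cmod (f v))"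
      using that by (simp add: F_def norm_mult nonneg)
    ultimately show ?thesis
      by (simp add: distrib_left mult_ac)
  qed
  then have "(\<lambda>p. norm (F p)) summable_on V \<times> V"
    by (intro Infinite_Sum.abs_summable_on_comparison_test' [OF dom]) auto
  then have F_sum: "F summable_on V \<times> V"
    by (rule abs_summable_summable)
  have "infsum F (V \<times> V) = (\<Sum>\<^sub>\<infinity>v\<in>V. \<Sum>\<^sub>\<infinity>u\<in>V. F (v, u))"
    by (rule infsum_Sigma_banach [OF F_sum, symmetric])
  also have "\<dots> = L2_inner V (laplacian V w f) f"
    unfolding L2_inner_def
    by (intro infsum_cong) (simp add: F_def laplacian_def infsum_cmult_left')
  finally have F: "(F has_sum L2_inner V (laplacian V w f) f) (V \<times> V)"
    using has_sum_infsum [OF F_sum] by simp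
  then have "((\<lambda>(v, u). F (u, v)) has_sum L2_inner V (laplacian V w f) f) (V \<times> V)"
    by (subst (asm) has_sum_swap)
  with F have "((\<lambda>p. Re (F p) + Re (case p of (v, u) \<Rightarrow> F (u, v))) has_sum
      2 * Re (L2_inner V (laplacian V w f) f)) (V \<times> V)"
    unfolding mult_2 by (intro has_sum_add has_sum_Re)
  \<comment> \<open>Adding \<open>F\<close> to its transpose combines \<open>cnj (f v)\<close> and
    \<open>- cnj (f u)\<close> into the conjugate of \<open>f v - f u\<close>.\<close>
  moreover have "w v u * (cmod (f v - f u))\<^sup>2 = Re (F (v, u)) + Re (F (u, v))"
    if "v \<in> V" "u \<in> V" for v u
    unfolding cmod_power2 by (simp add: F_def sym [OF that] power2_eq_square algebra_simps)
  then have "?thesis \<longleftrightarrow> ((\<lambda>p. Re (F p) + Re (case p of (v, u) \<Rightarrow> F (u, v))) has_sum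
      2 * Re (L2_inner V (laplacian V w f) f)) (V \<times> V)"
    by (intro has_sum_cong) auto
  ultimately show ?thesis
    by blast
qed

section \<open>Summation over the blocks\<close>

text \<open>Disjointness makes \<open>snd\<close> a bijection from \<open>Sigma J X\<close> onto the
  union; summing over the fibres then regroups the series. It serves for vertices and for pairs of
  vertices alike.\<close>

lemma has_sum_disjoint_family:
  fixes g :: "'a \<Rightarrow> real"
  assumes g: "(g has_sum s) (\<Union>j\<in>J. X j)" and disj: "disjoint_family_on X J"
    and fin: "\<And>j. j \<in> J \<Longrightarrow> finite (X j)"
  shows "((\<lambda>j. sum g (X j)) has_sum s) J"
proof -
  have "bij_betw snd (Sigma J X) (\<Union>j\<in>J. X j)"
  proof (rule bij_betw_imageI)
    show "inj_on snd (Sigma J X)"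
      using disj by (auto simp: inj_on_def disjoint_family_on_def)
    show "snd ` Sigma J X = (\<Union>j\<in>J. X j)"
      by force
  qed
  then have "((\<lambda>p. g (snd p)) has_sum s) (Sigma J X)"
    using g by (simp add: has_sum_reindex_bij_betw)
  then show ?thesis
    by (rule has_sum_SigmaD) (use fin in auto)
qed

lemma L2_inner_normalized_indicator:
  assumes "finite S" "S \<subseteq> V"
  shows "(cmod (L2_inner V f (normalized_indicator S)))\<^sup>2 = (cmod (\<Sum>v\<in>S. f v))\<^sup>2 / card S"
proof -
  have "L2_inner V f (normalized_indicator S) = (\<Sum>\<^sub>\<infinity>v\<in>S. f v * of_real (1 / sqrt (card S)))"
    unfolding L2_inner_def using assms(2)
    by (intro infsum_cong_neutral) (auto simp: normalized_indicator_def)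
  also have "\<dots> = (\<Sum>v\<in>S. f v) * of_real (1 / sqrt (card S))"
    using assms(1) by (simp add: sum_divide_distrib)
  finally show ?thesis
    by (simp add: norm_mult norm_divide power_divide power_mult_distrib)
qed

text \<open>Cauchy-Schwarz against the constant 1. When \<open>card S = 0\<close> the quotient is 0
  by convention.\<close>

lemma cmod_sum_square_le: "(cmod (\<Sum>v\<in>S. f v))\<^sup>2 / card S \<le> (\<Sum>v\<in>S. (cmod (f v))\<^sup>2)"
proof (cases "card S = 0")
  case False
  have "(cmod (\<Sum>v\<in>S. f v))\<^sup>2 \<le> (\<Sum>v\<in>S. cmod (f v))\<^sup>2"
    by (intro power_mono norm_sum) simp
  also have "\<dots> \<le> (\<Sum>v\<in>S. (cmod (f v))\<^sup>2) * card S"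
    by (rule sum_squared_le_sum_of_squares)
  finally show ?thesis
    using False by (simp add: field_simps)
qed (simp add: sum_nonneg)

lemma block_average_frame_bounds:
  fixes V :: "'v set" and w :: "'v \<Rightarrow> 'v \<Rightarrow> real" and J :: "'j set" and \<Omega> :: "'j \<Rightarrow> 'v set"
  assumes wg: "weighted_graph V w"
    and disj: "disjoint_family_on \<Omega> J" and cover: "(\<Union>j\<in>J. \<Omega> j) = V"
    and fin: "\<And>j. j \<in> J \<Longrightarrow> finite (\<Omega> j)"
    and card: "\<And>j. j \<in> J \<Longrightarrow> 1 < card (\<Omega> j)"
    and conn: "\<And>j. j \<in> J \<Longrightarrow> connected_graph (\<Omega> j) w"
    and \<Lambda>: "\<Lambda> = (INF j\<in>J. first_nonzero_eigenvalue (\<Omega> j) w)" "0 < \<Lambda>"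
    and f: "f \<in> paley_wiener V w \<omega>"
  defines "a \<equiv> \<lambda>j. (cmod (L2_inner V f (normalized_indicator (\<Omega> j))))\<^sup>2"
  shows "a summable_on J" and "infsum a J \<le> (L2_norm V f)\<^sup>2"
    and "(1 - \<omega> / \<Lambda>) * (L2_norm V f)\<^sup>2 \<le> infsum a J"
proof -
  have f_L2: "f \<in> L2 V"
    using f paley_wiener_subset_L2 by blast
  have sub: "\<Omega> j \<subseteq> V" if "j \<in> J" for j
    using cover that by blast
  have sym: "w v u = w u v" and nonneg: "0 \<le> w u v" if "u \<in> V" "v \<in> V" for u v
    using wg that by (auto simp: weighted_graph_def)
  define b where "b j = (\<Sum>v\<in>\<Omega> j. (cmod (f v))\<^sup>2)" for j
  define G where "G = (\<lambda>(v, u). w v u * (cmod (f v - f u))\<^sup>2)"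
  define e where "e j = sum G (\<Omega> j \<times> \<Omega> j)" for j
  \<comment> \<open>The ordered pairs lying in a common block; the cross-block terms of
    \<open>G\<close> are non-negative and get dropped.\<close>
  define U where "U = (\<Union>j\<in>J. \<Omega> j \<times> \<Omega> j)"
  have "((\<lambda>v. (cmod (f v))\<^sup>2) has_sum (L2_norm V f)\<^sup>2) (\<Union>j\<in>J. \<Omega> j)"
    using f_L2 by (auto simp: L2_norm_power2 cover L2_def intro: has_sum_infsum)
  then have b: "(b has_sum (L2_norm V f)\<^sup>2) J"
    unfolding b_def using disj fin by (rule has_sum_disjoint_family)
  have a_eq: "a j = (cmod (\<Sum>v\<in>\<Omega> j. f v))\<^sup>2 / card (\<Omega> j)" if "j \<in> J" for j
    unfolding a_def using that by (intro L2_inner_normalized_indicator fin sub)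
  have a_le_b: "a j \<le> b j" if "j \<in> J" for j
    unfolding a_eq [OF that] b_def by (rule cmod_sum_square_le)
  show a_sum: "a summable_on J"
    by (rule summable_on_comparison_test [OF has_sum_imp_summable [OF b] a_le_b])
      (simp_all add: a_def)
  then have a: "(a has_sum infsum a J) J"
    by (rule has_sum_infsum)
  show "infsum a J \<le> (L2_norm V f)\<^sup>2"
    using a b a_le_b by (rule has_sum_mono)
  have G: "(G has_sum 2 * Re (L2_inner V (laplacian V w f) f)) (V \<times> V)"
    unfolding G_def by (rule laplacian_form_has_sum [OF wg f_L2])
  have "U \<subseteq> V \<times> V"
    using sub by (auto simp: U_def)
  then have G_U: "(G has_sum infsum G U) U"
    using G has_sum_imp_summable summable_on_subset_banach has_sum_infsum by blast
  have e: "(e has_sum infsum G U) J"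
    unfolding e_def
  proof (rule has_sum_disjoint_family)
    show "(G has_sum infsum G U) (\<Union>j\<in>J. \<Omega> j \<times> \<Omega> j)"
      using G_U by (simp only: U_def)
    show "disjoint_family_on (\<lambda>j. \<Omega> j \<times> \<Omega> j) J"
      using disj by (fastforce simp: disjoint_family_on_def)
  qed (use fin in auto)
  have "infsum G U \<le> 2 * Re (L2_inner V (laplacian V w f) f)"
    using G_U G by (rule has_sum_mono2) (use \<open>U \<subseteq> V \<times> V\<close> in \<open>auto simp: G_def nonneg\<close>)
  also have "\<dots> \<le> 2 * (\<omega> * (L2_norm V f)\<^sup>2)"
    using paley_wiener_laplacian_form_le [OF f] by simp
  finally have G_le: "infsum G U \<le> 2 * (\<omega> * (L2_norm V f)\<^sup>2)" .
  have local: "\<Lambda> * (b j - a j) \<le> 1 / 2 * e j" if "j \<in> J" for j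
  proof -
    have w_j: "\<And>u v. u \<in> \<Omega> i \<Longrightarrow> v \<in> \<Omega> i \<Longrightarrow> w u v = w v u"
      "\<And>u v. u \<in> \<Omega> i \<Longrightarrow> v \<in> \<Omega> i \<Longrightarrow> 0 \<le> w u v" if "i \<in> J" for i
      using sub [OF that] sym nonneg by blast+
    \<comment> \<open>A real infimum is a lower bound only for a family bounded below; here 0 bounds
      the eigenvalues.\<close>
    have "bdd_below ((\<lambda>j. first_nonzero_eigenvalue (\<Omega> j) w) ` J)"
      using first_nonzero_eigenvalue_nonneg [of "\<Omega> i" w for i, OF fin card w_j conn] by (intro bdd_belowI2)
    then have "\<Lambda> \<le> first_nonzero_eigenvalue (\<Omega> j) w"
      unfolding \<Lambda>(1) using that by (rule cINF_lower)
    then have "\<Lambda> * (b j - a j) \<le> first_nonzero_eigenvalue (\<Omega> j) w * (b j - a j)"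
      using a_le_b [OF that] by (intro mult_right_mono) auto
    also have "\<dots> \<le> (\<Sum>u\<in>\<Omega> j. \<Sum>v\<in>\<Omega> j. w u v * (cmod (f u - f v))\<^sup>2) / 2"
      unfolding b_def a_eq [OF that]
      by (rule first_nonzero_eigenvalue_poincare [OF fin card w_j conn]) (use that in auto)
    also have "\<dots> = 1 / 2 * e j"
      by (simp add: e_def G_def sum.cartesian_product)
    finally show ?thesis .
  qed
  have "((\<lambda>j. \<Lambda> * b j + - \<Lambda> * a j) has_sum \<Lambda> * (L2_norm V f)\<^sup>2 + - \<Lambda> * infsum a J) J"
    by (intro has_sum_add has_sum_cmult_right a b)
  then have "\<Lambda> * (L2_norm V f)\<^sup>2 + - \<Lambda> * infsum a J \<le> 1 / 2 * infsum G U"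
    using has_sum_cmult_right [OF e, of "1 / 2"]
    by (rule has_sum_mono) (use local in \<open>simp add: right_diff_distrib\<close>)
  with G_le have "\<Lambda> * ((L2_norm V f)\<^sup>2 - infsum a J) \<le> \<omega> * (L2_norm V f)\<^sup>2"
    by (simp add: right_diff_distrib)
  with \<Lambda>(2) show "(1 - \<omega> / \<Lambda>) * (L2_norm V f)\<^sup>2 \<le> infsum a J"
    by (simp add: field_simps)
qed

theorem theorem9p1:
  fixes V :: "'v set" and w :: "'v \<Rightarrow> 'v \<Rightarrow> real"
    and J :: "'j set" and \<Omega> :: "'j \<Rightarrow> 'v set"
    and \<Lambda> \<alpha> \<omega> \<gamma> :: real
    and \<xi> :: "'j \<Rightarrow> 'v \<Rightarrow> complex"
  assumes "weighted_graph V w" and "connected_graph V w"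
    and "disjoint_family_on \<Omega> J" and "(\<Union>j\<in>J. \<Omega> j) = V"
    and "\<And>j. j \<in> J \<Longrightarrow> finite (\<Omega> j)"
    and "\<And>j. j \<in> J \<Longrightarrow> 1 < card (\<Omega> j)"
    and "\<And>j. j \<in> J \<Longrightarrow> connected_graph (\<Omega> j) w"
    and "\<Lambda> = (INF j\<in>J. first_nonzero_eigenvalue (\<Omega> j) w)" and "0 < \<Lambda>"
    and "0 < \<alpha>" and "0 < \<omega>"
    and "\<gamma> = (1 + \<alpha>) / \<alpha> * (\<omega> / \<Lambda>)" and "\<gamma> < 1"
    and "\<And>j. \<xi> j = normalized_indicator (\<Omega> j)"
  shows "frame_of_functionals V (paley_wiener V w \<omega>) J (\<lambda>j f. L2_inner V f (\<xi> j)) \<and>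
    (\<forall>f\<in>paley_wiener V w \<omega>.
       (\<lambda>j. (cmod (L2_inner V f (\<xi> j)))\<^sup>2) summable_on J \<and>
       (1 - \<gamma>) / (1 + \<alpha>) * (L2_norm V f)\<^sup>2 \<le> (\<Sum>\<^sub>\<infinity>j\<in>J. (cmod (L2_inner V f (\<xi> j)))\<^sup>2) \<and>
       (\<Sum>\<^sub>\<infinity>j\<in>J. (cmod (L2_inner V f (\<xi> j)))\<^sup>2) \<le> (L2_norm V f)\<^sup>2)"
proof -
  define x where "x = \<omega> / \<Lambda>"
  have "0 < x"
    using assms(9,11) by (simp add: x_def)
  have \<gamma>: "\<gamma> = (1 + \<alpha>) / \<alpha> * x"
    using assms(12) by (simp add: x_def)
  then have "(1 + \<alpha>) * x = \<alpha> * \<gamma>"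
    using \<open>0 < \<alpha>\<close> by simp
  \<comment> \<open>Both terms on the right are non-negative, so the claimed lower constant is at
    most \<open>1 - x\<close>.\<close>
  then have "(1 + \<alpha>) * (1 - x) - (1 - \<gamma>) = \<alpha> * (1 - \<gamma>) + \<gamma>"
    by (simp add: algebra_simps)
  moreover have "0 \<le> \<alpha> * (1 - \<gamma>)"
    using \<open>0 < \<alpha>\<close> \<open>\<gamma> < 1\<close> by simp
  moreover have "0 < \<gamma>"
    using \<open>0 < \<alpha>\<close> \<open>0 < x\<close> by (simp add: \<gamma>)
  ultimately have "1 - \<gamma> \<le> (1 + \<alpha>) * (1 - x)"
    by linarith
  then have const: "(1 - \<gamma>) / (1 + \<alpha>) \<le> 1 - \<omega> / \<Lambda>"
    using \<open>0 < \<alpha>\<close> by (simp add: x_def [symmetric] pos_divide_le_eq mult.commute)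
  have bounds: "(\<lambda>j. (cmod (L2_inner V f (\<xi> j)))\<^sup>2) summable_on J \<and>
       (1 - \<gamma>) / (1 + \<alpha>) * (L2_norm V f)\<^sup>2 \<le> (\<Sum>\<^sub>\<infinity>j\<in>J. (cmod (L2_inner V f (\<xi> j)))\<^sup>2) \<and>
       (\<Sum>\<^sub>\<infinity>j\<in>J. (cmod (L2_inner V f (\<xi> j)))\<^sup>2) \<le> (L2_norm V f)\<^sup>2"
    if f: "f \<in> paley_wiener V w \<omega>" for f
    using block_average_frame_bounds [OF assms(1,3-9) f]
      mult_right_mono [OF const, of "(L2_norm V f)\<^sup>2"]
    by (auto simp: assms(14) intro: order_trans)
  \<comment> \<open>The frame property demands a positive lower bound, which is where
    \<open>\<gamma> < 1\<close> enters.\<close>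
  moreover have "0 < (1 - \<gamma>) / (1 + \<alpha>)"
    using assms(10,13) by simp
  ultimately have "frame_of_functionals V (paley_wiener V w \<omega>) J (\<lambda>j f. L2_inner V f (\<xi> j))"
    unfolding frame_of_functionals_def
    by (intro exI [of _ "(1 - \<gamma>) / (1 + \<alpha>)"] exI [of _ "1::real"]) simp
  with bounds show ?thesis
    by blast
qed

end
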